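(* Let $(\mathcal{A},\varepsilon)$ be a signed support in $\mathbb{R}^n$ with Gale dual matrix $B$. Then the following are equivalent: (i) the signed $A$-discriminant is empty: $\nabla_{\mathcal{A},\varepsilon}=\emptyset$; (ii) the signed reduced $A$-discriminant is empty: $\Gamma_\varepsilon(A,B)=\emptyset$; (iii) $(\mathcal{A},\varepsilon)$ has a non-trivial separating hyperplane.
   Context: A signed support $(\mathcal{A},\varepsilon)$ in $\mathbb{R}^n$ consists of a finite set $\mathcal{A}=\{\alpha_1,\dots,\alpha_{n+k+1}\}\subseteq\mathbb{R}^n$ of (distinct) exponent vectors and a sign distribution $\varepsilon\in\{\pm1\}^{n+k+1}$. Put $\mathcal{A}_+=\{\alpha_i:\varepsilon_i=1\}$, $\mathcal{A}_-=\{\alpha_i:\varepsilon_i=-1\}$ and $\mathbb{R}^{\mathcal{A}}_\varepsilon=\{c\in\mathbb{R}^{n+k+1}:\operatorname{sign}(c)=\varepsilon\}$ (coordinate-wise signs). For $c\in\mathbb{R}^{\mathcal{A}}_\varepsilon$ let $f_c:\mathbb{R}^n\to\mathbb{R}$, $f_c(x)=\sum_{i=1}^{n+k+1}c_i e^{\alpha_i\cdot x}$, and let $\operatorname{Sing}(f_c)$ be the set of $x\in\mathbb{R}^n$ with $f_c(x)=\partial f_c/\partial x_1(x)=\dots=\partial f_c/\partial x_n(x)=0$. The signed $A$-discriminant is $\nabla_{\mathcal{A},\varepsilon}=\{c\in\mathbb{R}^{\mathcal{A}}_\varepsilon:\operatorname{Sing}(f_c)\neq\emptyset\}$. Let $\hat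 A\in\mathbb{R}^{(n+1)\times(n+k+1)}$ be the matrix whose $i$-th column is $(1,\alpha_i)^\top$. A Gale dual matrix $B$ of $\mathcal{A}$ is a matrix whose columns form a basis of $\ker(\hat A)$ (so $B\in\mathbb{R}^{(n+k+1)\times k}$ when $\dim\operatorname{Conv}(\mathcal{A})=n$). The signed reduced $A$-discriminant is $\Gamma_\varepsilon(A,B)=\{B^\top\operatorname{Log}|c| : c\in\nabla_{\mathcal{A},\varepsilon}\}$, where $\operatorname{Log}$ and $|\cdot|$ are the coordinate-wise natural logarithm and absolute value. For $v\in\mathbb{R}^n\setminus\{0\}$, $a\in\mathbb{R}$ let $\mathcal{H}_{v,a}=\{\mu:v\cdot\mu=a\}$, $\mathcal{H}^+_{v,a}=\{\mu:v\cdot\mu\ge a\}$, $\mathcal{H}^-_{v,a}=\{\mu:v\cdot\mu\le a\}$. $\mathcal{H}_{v,a}$ is a separating hyperplane of $(\mathcal{A},\varepsilon)$ if $\mathcal{A}_+\subseteq\mathcal{H}^+_{v,a}$ and $\mathcal{A}_-\subseteq\mathcal{H}^-_{v,a}$; it is non-trivial if at least one of the open half-spaces $\operatorname{int}(\mathcal{H}^+_{v,a})$, $\operatorname{int}(\mathcal{H}^-_{v,a})$ contains a point of $\mathcal{A}$. *)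

theory Defs
  imports Complex_Main "Jordan_Normal_Form.Matrix_Kernel"
begin

text \<open>
  Vector and matrix dimensions are natural numbers, because the number of columns of a Gale dual
  matrix is the dimension of a kernel and may be 0.  The list \<open>\<alpha>\<close> enumerates the exponent vectors
  \<open>\<alpha>\<^sub>1, \<dots>, \<alpha>\<^sub>m\<close> with \<open>m = n + k + 1\<close>; neither \<open>k \<ge> 0\<close> nor full-dimensionality of their convex hull
  is required.
\<close>

definition signed_support :: "nat \<Rightarrow> real vec list \<Rightarrow> real vec \<Rightarrow> bool" where
  "signed_support n \<alpha> \<epsilon> \<longleftrightarrow>
     set \<alpha> \<subseteq> carrier_vec n \<and> distinct \<alpha> \<and>
     \<epsilon> \<in> carrier_vec (length \<alpha>) \<and> (\<forall>i < length \<alpha>. \<epsilon> $ i \<in> {1, -1})"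

definition positive_exponents :: "real vec list \<Rightarrow> real vec \<Rightarrow> real vec set" where
  "positive_exponents \<alpha> \<epsilon> = {\<alpha> ! i | i. i < length \<alpha> \<and> \<epsilon> $ i = 1}"

definition negative_exponents :: "real vec list \<Rightarrow> real vec \<Rightarrow> real vec set" where
  "negative_exponents \<alpha> \<epsilon> = {\<alpha> ! i | i. i < length \<alpha> \<and> \<epsilon> $ i = -1}"

definition coefficient_orthant :: "real vec list \<Rightarrow> real vec \<Rightarrow> real vec set" where
  "coefficient_orthant \<alpha> \<epsilon> = {c \<in> carrier_vec (length \<alpha>). map_vec sgn c = \<epsilon>}"

definition exp_sum :: "real vec list \<Rightarrow> real vec \<Rightarrow> real vec \<Rightarrow> real" where
  "exp_sum \<alpha> c x = (\<Sum>i < length \<alpha>. c $ i * exp ((\<alpha> ! i) \<bullet> x))"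

text \<open>\<open>(\<partial>f/\<partial>x\<^sub>j)(x) = d\<close>, as the derivative along the \<open>j\<close>-th coordinate line (\<open>j\<close> counted from 0).\<close>

definition has_partial_derivative ::
    "nat \<Rightarrow> (real vec \<Rightarrow> real) \<Rightarrow> nat \<Rightarrow> real \<Rightarrow> real vec \<Rightarrow> bool" where
  "has_partial_derivative n f j d x \<longleftrightarrow>
     ((\<lambda>t. f (x + t \<cdot>\<^sub>v unit_vec n j)) has_real_derivative d) (at 0)"

definition Sing :: "nat \<Rightarrow> (real vec \<Rightarrow> real) \<Rightarrow> real vec set" where
  "Sing n f = {x \<in> carrier_vec n. f x = 0 \<and> (\<forall>j < n. has_partial_derivative n f j 0 x)}"

definition signed_discriminant :: "nat \<Rightarrow> real vec list \<Rightarrow> real vec \<Rightarrow> real vec set" where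
  "signed_discriminant n \<alpha> \<epsilon> = {c \<in> coefficient_orthant \<alpha> \<epsilon>. Sing n (exp_sum \<alpha> c) \<noteq> {}}"

definition Ahat :: "nat \<Rightarrow> real vec list \<Rightarrow> real mat" where
  "Ahat n \<alpha> = mat_of_cols (n + 1) (map (vCons 1) \<alpha>)"

definition gale_dual_matrix :: "nat \<Rightarrow> real vec list \<Rightarrow> real mat \<Rightarrow> bool" where
  "gale_dual_matrix n \<alpha> B \<longleftrightarrow>
     dim_row B = length \<alpha> \<and> distinct (cols B) \<and>
     kernel.basis (length \<alpha>) (Ahat n \<alpha>) (set (cols B))"

definition Log_abs :: "real vec \<Rightarrow> real vec" where
  "Log_abs c = map_vec (\<lambda>t. ln \<bar>t\<bar>) c"

definition signed_reduced_discriminant ::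
    "nat \<Rightarrow> real vec list \<Rightarrow> real vec \<Rightarrow> real mat \<Rightarrow> real vec set" where
  "signed_reduced_discriminant n \<alpha> \<epsilon> B =
     {transpose_mat B *\<^sub>v Log_abs c | c. c \<in> signed_discriminant n \<alpha> \<epsilon>}"

definition halfspace_ge :: "nat \<Rightarrow> real vec \<Rightarrow> real \<Rightarrow> real vec set" where
  "halfspace_ge n v a = {\<mu> \<in> carrier_vec n. v \<bullet> \<mu> \<ge> a}"

definition halfspace_le :: "nat \<Rightarrow> real vec \<Rightarrow> real \<Rightarrow> real vec set" where
  "halfspace_le n v a = {\<mu> \<in> carrier_vec n. v \<bullet> \<mu> \<le> a}"

text \<open>The open half-spaces are the interiors of the closed ones when \<open>v\<close> is nonzero.\<close>

definition open_halfspace_gt :: "nat \<Rightarrow> real vec \<Rightarrow> real \<Rightarrow> real vec set" where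
  "open_halfspace_gt n v a = {\<mu> \<in> carrier_vec n. v \<bullet> \<mu> > a}"

definition open_halfspace_lt :: "nat \<Rightarrow> real vec \<Rightarrow> real \<Rightarrow> real vec set" where
  "open_halfspace_lt n v a = {\<mu> \<in> carrier_vec n. v \<bullet> \<mu> < a}"

definition separating_hyperplane ::
    "nat \<Rightarrow> real vec list \<Rightarrow> real vec \<Rightarrow> real vec \<Rightarrow> real \<Rightarrow> bool" where
  "separating_hyperplane n \<alpha> \<epsilon> v a \<longleftrightarrow>
     v \<in> carrier_vec n \<and> v \<noteq> 0\<^sub>v n \<and>
     positive_exponents \<alpha> \<epsilon> \<subseteq> halfspace_ge n v a \<and>
     negative_exponents \<alpha> \<epsilon> \<subseteq> halfspace_le n v a"

definition nontrivial_separating_hyperplane ::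
    "nat \<Rightarrow> real vec list \<Rightarrow> real vec \<Rightarrow> real vec \<Rightarrow> real \<Rightarrow> bool" where
  "nontrivial_separating_hyperplane n \<alpha> \<epsilon> v a \<longleftrightarrow>
     separating_hyperplane n \<alpha> \<epsilon> v a \<and>
     (open_halfspace_gt n v a \<inter> set \<alpha> \<noteq> {} \<or> open_halfspace_lt n v a \<inter> set \<alpha> \<noteq> {})"

end

theory Submission
  imports Defs
begin

text \<open>
  The reduced discriminant is an image of the discriminant, so (i) and (ii) are equivalent at once.
  For (i) and (iii), let \<open>x\<close> be a singular point of \<open>f\<^sub>c\<close> and put \<open>w\<^sub>i = c\<^sub>i exp (\<alpha>\<^sub>i \<bullet> x)\<close>.  The
  singularity equations are linear in \<open>w\<close>: they say that \<open>w\<close> is an affine dependence of the exponents,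
  that is \<open>\<Sum> w\<^sub>i = 0\<close> and \<open>\<Sum> w\<^sub>i \<alpha>\<^sub>i = 0\<close>, and \<open>w\<close> has the signs of \<open>c\<close>.  Conversely, an
  affine dependence with these signs is itself a coefficient vector, with singular point 0.  Hence
  the discriminant is nonempty iff the vectors \<open>\<epsilon>\<^sub>i (1, \<alpha>\<^sub>i)\<close> have a strictly positive linear
  dependence (\<open>signed_discriminant_nonempty_iff\<close>).

  By Stiemke's theorem of the alternative (\<open>stiemke\<close>), such a dependence is missing exactly when
  some \<open>(b, v)\<close> satisfies \<open>\<epsilon>\<^sub>i (b + \<alpha>\<^sub>i \<bullet> v) \<ge> 0\<close> for all \<open>i\<close>, with strict inequality for
  at least one \<open>i\<close>.  This is a nontrivial separating hyperplane \<open>v \<bullet> \<mu> = -b\<close>, except that \<open>v\<close>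
  could be 0; then all signs agree, and a hyperplane with all exponents strictly on one side will do
  (\<open>nontrivial_separating_hyperplane_iff\<close>).  Stiemke's theorem is in turn obtained by adding up
  certificates supplied by Farkas' lemma (\<open>farkas\<close>).
\<close>

section \<open>Theorems of the alternative\<close>

text \<open>
  The induction on the number of constraints follows Bartl.  If the constraints without the new one
  \<open>a\<^sub>k\<close> do not already imply the conclusion, a witness \<open>p\<close> of this has \<open>a\<^sub>k \<bullet> p < 0\<close>, and
  \<open>x \<mapsto> x + (a\<^sub>k \<bullet> x) p\<close> becomes, after scaling \<open>p\<close>, a projection onto the kernel of \<open>a\<^sub>k\<close>.
  The induction hypothesis is applied to the functionals composed with this projection.
  The conclusion compares functionals, which spares sums of vectors.
\<close>

lemma farkas:
  fixes a :: "'i \<Rightarrow> real vec" and g :: "real vec"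
  assumes "finite I"
    and "\<And>i. i \<in> I \<Longrightarrow> a i \<in> carrier_vec d"
    and "g \<in> carrier_vec d"
    and "\<And>x. x \<in> carrier_vec d \<Longrightarrow> (\<And>i. i \<in> I \<Longrightarrow> a i \<bullet> x \<ge> 0) \<Longrightarrow> g \<bullet> x \<ge> 0"
  shows "\<exists>l. (\<forall>i\<in>I. l i \<ge> 0) \<and> (\<forall>x\<in>carrier_vec d. g \<bullet> x = (\<Sum>i\<in>I. l i * (a i \<bullet> x)))"
  using assms
proof (induction I arbitrary: a g rule: finite_induct)
  case empty
  \<comment> \<open>No constraints: \<open>x = -g\<close> gives \<open>g \<bullet> g \<le> 0\<close>.\<close>
  have "g \<bullet> (- g) \<ge> 0"
    using empty(2) by (intro empty(3)) auto
  moreover have "g \<bullet> (- g) = - (g \<bullet> g)"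
    using empty(2) by (intro scalar_prod_uminus_right) simp
  ultimately have "g \<bullet> g \<le> 0"
    by simp
  then have "(\<Sum>j<d. g $ j * g $ j) = 0"
    using empty(2) sum_nonneg[of "{..<d}" "\<lambda>j. g $ j * g $ j"]
    by (simp add: scalar_prod_def atLeast0LessThan)
  then have "g = 0\<^sub>v d"
    using empty(2) by (intro eq_vecI) (auto simp: sum_nonneg_eq_0_iff)
  then show ?case
    by auto
next
  case (insert k I)
  have ai: "a i \<in> carrier_vec d" if "i \<in> I" for i
    using insert.prems(1) that by simp
  have ak: "a k \<in> carrier_vec d"
    using insert.prems(1) by simp
  note g = insert.prems(2)
  show ?case
  proof (cases "\<forall>x\<in>carrier_vec d. (\<forall>i\<in>I. a i \<bullet> x \<ge> 0) \<longrightarrow> g \<bullet> x \<ge> 0")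
    case True
    then obtain l where l: "\<forall>i\<in>I. l i \<ge> 0"
        "\<forall>x\<in>carrier_vec d. g \<bullet> x = (\<Sum>i\<in>I. l i * (a i \<bullet> x))"
      using insert.IH[of a g] ai g by blast
    have "(\<Sum>i\<in>I. (l(k := 0)) i * (a i \<bullet> x)) = (\<Sum>i\<in>I. l i * (a i \<bullet> x))" for x
      using insert.hyps by (intro sum.cong) auto
    then show ?thesis
      using l insert.hyps by (intro exI[of _ "l(k := 0)"]) auto
  next
    case False
    then obtain q where q: "q \<in> carrier_vec d" "\<forall>i\<in>I. a i \<bullet> q \<ge> 0" "g \<bullet> q < 0"
      by (auto simp: not_le)
    have neg: "a k \<bullet> q < 0"
      using insert.prems(3)[OF q(1)] q(2,3) by (metis insert_iff not_le)
    define p where "p = (1 / - (a k \<bullet> q)) \<cdot>\<^sub>v q"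
    have p: "p \<in> carrier_vec d"
      using q(1) by (simp add: p_def)
    have akp: "a k \<bullet> p = -1"
      using neg ak q(1) by (simp add: p_def)
    have aip: "a i \<bullet> p \<ge> 0" if "i \<in> I" for i
      using that q neg ai[OF that] by (simp add: p_def divide_nonneg_neg)
    have gp: "g \<bullet> p < 0"
      using q neg g by (simp add: p_def divide_neg_neg)
    define a' where "a' i = a i + (a i \<bullet> p) \<cdot>\<^sub>v a k" for i
    define g' where "g' = g + (g \<bullet> p) \<cdot>\<^sub>v a k"
    have a': "a' i \<in> carrier_vec d" if "i \<in> I" for i
      using ai[OF that] ak by (simp add: a'_def)
    have g': "g' \<in> carrier_vec d"
      using g ak by (simp add: g'_def)
    have a'x: "a' i \<bullet> x = a i \<bullet> x + (a i \<bullet> p) * (a k \<bullet> x)" if "i \<in> I" "x \<in> carrier_vec d" for i x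
      using ai ak that by (simp add: a'_def add_scalar_prod_distrib[of _ d])
    have g'x: "g' \<bullet> x = g \<bullet> x + (g \<bullet> p) * (a k \<bullet> x)" if "x \<in> carrier_vec d" for x
      using g ak that by (simp add: g'_def add_scalar_prod_distrib[of _ d])
    have "g' \<bullet> x \<ge> 0" if x: "x \<in> carrier_vec d" and "\<And>i. i \<in> I \<Longrightarrow> a' i \<bullet> x \<ge> 0" for x
    proof -
      define y where "y = x + (a k \<bullet> x) \<cdot>\<^sub>v p"
      have y: "y \<in> carrier_vec d"
        using x p by (simp add: y_def)
      have uy: "u \<bullet> y = u \<bullet> x + (u \<bullet> p) * (a k \<bullet> x)" if "u \<in> carrier_vec d" for u
        using that x p by (simp add: y_def scalar_prod_add_distrib[of _ d])
      have "a i \<bullet> y \<ge> 0" if "i \<in> insert k I" for i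
      proof (cases "i = k")
        case True
        then show ?thesis
          using uy[OF ak] akp by simp
      next
        case False
        then have "i \<in> I"
          using that by simp
        then show ?thesis
          using \<open>\<And>i. i \<in> I \<Longrightarrow> a' i \<bullet> x \<ge> 0\<close>[of i] a'x[of i x] uy[OF ai] x by simp
      qed
      then have "g \<bullet> y \<ge> 0"
        using insert.prems(3)[OF y] by blast
      then show ?thesis
        using g'x[OF x] uy[OF g] by simp
    qed
    then obtain l where l: "\<forall>i\<in>I. l i \<ge> 0"
        "\<forall>x\<in>carrier_vec d. g' \<bullet> x = (\<Sum>i\<in>I. l i * (a' i \<bullet> x))"
      using insert.IH[of a' g'] a' g' by blast
    define s where "s = (\<Sum>i\<in>I. l i * (a i \<bullet> p)) - g \<bullet> p"
    have "s \<ge> 0"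
      using gp sum_nonneg[of I "\<lambda>i. l i * (a i \<bullet> p)"] l(1) aip by (simp add: s_def)
    have "g \<bullet> x = (\<Sum>i\<in>I. l i * (a i \<bullet> x)) + s * (a k \<bullet> x)" if x: "x \<in> carrier_vec d" for x
    proof -
      have "g \<bullet> x + (g \<bullet> p) * (a k \<bullet> x) = (\<Sum>i\<in>I. l i * (a' i \<bullet> x))"
        using l(2) x g'x by simp
      also have "\<dots> = (\<Sum>i\<in>I. l i * (a i \<bullet> x) + l i * (a i \<bullet> p) * (a k \<bullet> x))"
        using a'x x by (intro sum.cong) (simp_all add: algebra_simps)
      also have "\<dots> = (\<Sum>i\<in>I. l i * (a i \<bullet> x)) + (\<Sum>i\<in>I. l i * (a i \<bullet> p)) * (a k \<bullet> x)"
        by (simp add: sum.distrib sum_distrib_right)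
      finally show ?thesis
        by (simp add: s_def algebra_simps)
    qed
    moreover have "(\<Sum>i\<in>I. (l(k := s)) i * (a i \<bullet> x)) = (\<Sum>i\<in>I. l i * (a i \<bullet> x))" for x
      using insert.hyps by (intro sum.cong) auto
    ultimately show ?thesis
      using l(1) \<open>s \<ge> 0\<close> insert.hyps by (intro exI[of _ "l(k := s)"]) auto
  qed
qed

text \<open>
  By assumption, all \<open>a\<^sub>i \<bullet> x \<ge> 0\<close> only if all \<open>a\<^sub>i \<bullet> x = 0\<close>.  So Farkas' lemma puts
  each \<open>- a\<^sub>k\<close> into the cone of the \<open>a\<^sub>i\<close>; moving it to the other side gives a nonnegative dependence
  whose \<open>k\<close>-th coefficient is positive.  The sum of these over \<open>k\<close> is positive everywhere.
\<close>

lemma stiemke: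
  fixes a :: "'i \<Rightarrow> real vec"
  assumes fin: "finite I"
    and a: "\<And>i. i \<in> I \<Longrightarrow> a i \<in> carrier_vec d"
    and alt: "\<not> (\<exists>x\<in>carrier_vec d. (\<forall>i\<in>I. a i \<bullet> x \<ge> 0) \<and> (\<exists>i\<in>I. a i \<bullet> x > 0))"
  shows "\<exists>c. (\<forall>i\<in>I. c i > 0) \<and> (\<forall>x\<in>carrier_vec d. (\<Sum>i\<in>I. c i * (a i \<bullet> x)) = 0)"
proof -
  have "\<exists>l. (\<forall>i\<in>I. l i \<ge> 0) \<and> (\<forall>x\<in>carrier_vec d. - (a k \<bullet> x) = (\<Sum>i\<in>I. l i * (a i \<bullet> x)))"
    if k: "k \<in> I" for k
  proof -
    have "(- a k) \<bullet> x \<ge> 0" if "x \<in> carrier_vec d" "\<And>i. i \<in> I \<Longrightarrow> a i \<bullet> x \<ge> 0" for x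
    proof -
      have "\<not> a k \<bullet> x > 0"
        using alt that k by blast
      then show ?thesis
        using a[OF k] that(1) by simp
    qed
    then have "\<exists>l. (\<forall>i\<in>I. l i \<ge> 0) \<and>
        (\<forall>x\<in>carrier_vec d. (- a k) \<bullet> x = (\<Sum>i\<in>I. l i * (a i \<bullet> x)))"
      using a k by (intro farkas[OF fin]) auto
    then show ?thesis
      using a[OF k] by simp
  qed
  then obtain l where l_nonneg: "\<And>k i. k \<in> I \<Longrightarrow> i \<in> I \<Longrightarrow> l k i \<ge> (0::real)"
    and l: "\<And>k x. k \<in> I \<Longrightarrow> x \<in> carrier_vec d \<Longrightarrow>
              - (a k \<bullet> x) = (\<Sum>i\<in>I. l k i * (a i \<bullet> x))"
    by metis
  define c where "c i = 1 + (\<Sum>k\<in>I. l k i)" for i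
  have "c i > 0" if "i \<in> I" for i
    using sum_nonneg[of I "\<lambda>k. l k i"] l_nonneg that by (simp add: c_def add_pos_nonneg)
  moreover have "(\<Sum>i\<in>I. c i * (a i \<bullet> x)) = 0" if x: "x \<in> carrier_vec d" for x
  proof -
    have "(\<Sum>i\<in>I. c i * (a i \<bullet> x))
        = (\<Sum>i\<in>I. a i \<bullet> x) + (\<Sum>i\<in>I. \<Sum>k\<in>I. l k i * (a i \<bullet> x))"
      by (simp add: c_def algebra_simps sum.distrib sum_distrib_left)
    also have "(\<Sum>i\<in>I. \<Sum>k\<in>I. l k i * (a i \<bullet> x)) = (\<Sum>k\<in>I. \<Sum>i\<in>I. l k i * (a i \<bullet> x))"
      by (rule sum.swap)
    also have "\<dots> = (\<Sum>k\<in>I. - (a k \<bullet> x))"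
      using l x by simp
    finally show ?thesis
      by (simp add: sum_negf)
  qed
  ultimately show ?thesis
    by blast
qed

section \<open>Singular points and affine dependences\<close>

lemma exp_sum_partial_derivative:
  assumes "set \<alpha> \<subseteq> carrier_vec n" "x \<in> carrier_vec n" "j < n"
  shows "has_partial_derivative n (exp_sum \<alpha> c) j
           (\<Sum>i<length \<alpha>. c $ i * exp (\<alpha> ! i \<bullet> x) * \<alpha> ! i $ j) x"
proof -
  have "\<alpha> ! i \<bullet> (x + t \<cdot>\<^sub>v unit_vec n j) = \<alpha> ! i \<bullet> x + t * \<alpha> ! i $ j" if "i < length \<alpha>" for i t
  proof -
    have "\<alpha> ! i \<in> carrier_vec n"
      using assms(1) that by (auto simp: subset_iff)
    then show ?thesis
      using assms(2,3) by (simp add: scalar_prod_add_distrib[of _ n])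
  qed
  then have "exp_sum \<alpha> c (x + t \<cdot>\<^sub>v unit_vec n j)
      = (\<Sum>i<length \<alpha>. c $ i * exp (\<alpha> ! i \<bullet> x + t * \<alpha> ! i $ j))" for t
    by (simp add: exp_sum_def)
  then show ?thesis
    unfolding has_partial_derivative_def
    by (auto intro!: derivative_eq_intros sum.cong simp: algebra_simps)
qed

lemma mem_Sing_exp_sum_iff:
  assumes "set \<alpha> \<subseteq> carrier_vec n" "x \<in> carrier_vec n"
  shows "x \<in> Sing n (exp_sum \<alpha> c) \<longleftrightarrow>
           (\<Sum>i<length \<alpha>. c $ i * exp (\<alpha> ! i \<bullet> x)) = 0 \<and>
           (\<forall>j<n. (\<Sum>i<length \<alpha>. c $ i * exp (\<alpha> ! i \<bullet> x) * \<alpha> ! i $ j) = 0)"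
proof -
  have "has_partial_derivative n (exp_sum \<alpha> c) j 0 x \<longleftrightarrow>
      (\<Sum>i<length \<alpha>. c $ i * exp (\<alpha> ! i \<bullet> x) * \<alpha> ! i $ j) = 0" if "j < n" for j
    using exp_sum_partial_derivative[OF assms that, of c]
    unfolding has_partial_derivative_def by (auto dest: DERIV_unique)
  then show ?thesis
    using assms(2) by (auto simp: Sing_def exp_sum_def)
qed

text \<open>
  Multiplication by the positive numbers \<open>exp (\<alpha>\<^sub>i \<bullet> x)\<close> preserves the orthant, and at \<open>x = 0\<close> all of
  them are 1.
\<close>

lemma signed_discriminant_nonempty_iff:
  assumes "set \<alpha> \<subseteq> carrier_vec n"
  shows "signed_discriminant n \<alpha> \<epsilon> \<noteq> {} \<longleftrightarrow>
           (\<exists>w\<in>coefficient_orthant \<alpha> \<epsilon>. (\<Sum>i<length \<alpha>. w $ i) = 0 \<and>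
              (\<forall>j<n. (\<Sum>i<length \<alpha>. w $ i * \<alpha> ! i $ j) = 0))" (is "?L \<longleftrightarrow> ?R")
proof
  assume ?L
  then obtain c x where c: "c \<in> coefficient_orthant \<alpha> \<epsilon>" and x: "x \<in> Sing n (exp_sum \<alpha> c)"
    by (auto simp: signed_discriminant_def)
  have xc: "x \<in> carrier_vec n"
    using x by (simp add: Sing_def)
  define w where "w = vec (length \<alpha>) (\<lambda>i. c $ i * exp (\<alpha> ! i \<bullet> x))"
  have "w \<in> coefficient_orthant \<alpha> \<epsilon>"
    using c by (auto simp: coefficient_orthant_def w_def sgn_mult)
  then show ?R
    using x unfolding mem_Sing_exp_sum_iff[OF assms xc]
    by (intro bexI[of _ w]) (simp_all add: w_def)
next
  assume ?R
  then obtain w where w: "w \<in> coefficient_orthant \<alpha> \<epsilon>" "(\<Sum>i<length \<alpha>. w $ i) = 0"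
      "\<forall>j<n. (\<Sum>i<length \<alpha>. w $ i * \<alpha> ! i $ j) = 0"
    by blast
  have "\<alpha> ! i \<bullet> 0\<^sub>v n = 0" if "i < length \<alpha>" for i
    using assms that by (auto simp: subset_iff)
  then have "0\<^sub>v n \<in> Sing n (exp_sum \<alpha> w)"
    using w(2,3) by (simp add: mem_Sing_exp_sum_iff[OF assms])
  then show ?L
    using w(1) by (auto simp: signed_discriminant_def)
qed

section \<open>Separating hyperplanes as affine functions\<close>

lemma nontrivial_separating_hyperplane_affine_iff:
  assumes "signed_support n \<alpha> \<epsilon>"
  shows "nontrivial_separating_hyperplane n \<alpha> \<epsilon> v a \<longleftrightarrow>
           v \<in> carrier_vec n \<and> v \<noteq> 0\<^sub>v n \<and>
           (\<forall>i<length \<alpha>. \<epsilon> $ i * (\<alpha> ! i \<bullet> v - a) \<ge> 0) \<and>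
           (\<exists>i<length \<alpha>. \<epsilon> $ i * (\<alpha> ! i \<bullet> v - a) > 0)"
proof (cases "v \<in> carrier_vec n")
  case False
  then show ?thesis
    by (simp add: nontrivial_separating_hyperplane_def separating_hyperplane_def)
next
  case v: True
  have \<alpha>: "\<alpha> ! i \<in> carrier_vec n" if "i < length \<alpha>" for i
    using assms that by (auto simp: signed_support_def subset_iff)
  have comm: "v \<bullet> \<alpha> ! i = \<alpha> ! i \<bullet> v" if "i < length \<alpha>" for i
    using comm_scalar_prod[OF v \<alpha>[OF that]] .
  have \<epsilon>: "\<epsilon> $ i = 1 \<or> \<epsilon> $ i = -1" if "i < length \<alpha>" for i
    using assms that by (auto simp: signed_support_def)
  have "positive_exponents \<alpha> \<epsilon> \<subseteq> halfspace_ge n v a \<and> negative_exponents \<alpha> \<epsilon> \<subseteq> halfspace_le n v a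
      \<longleftrightarrow> (\<forall>i<length \<alpha>. (\<epsilon> $ i = 1 \<longrightarrow> \<alpha> ! i \<bullet> v \<ge> a) \<and> (\<epsilon> $ i = -1 \<longrightarrow> \<alpha> ! i \<bullet> v \<le> a))"
    using \<alpha> comm
    by (fastforce simp: positive_exponents_def negative_exponents_def halfspace_ge_def
        halfspace_le_def)
  also have "\<dots> \<longleftrightarrow> (\<forall>i<length \<alpha>. \<epsilon> $ i * (\<alpha> ! i \<bullet> v - a) \<ge> 0)"
    using \<epsilon> by fastforce
  finally have sep: "positive_exponents \<alpha> \<epsilon> \<subseteq> halfspace_ge n v a \<and>
      negative_exponents \<alpha> \<epsilon> \<subseteq> halfspace_le n v a \<longleftrightarrow>
      (\<forall>i<length \<alpha>. \<epsilon> $ i * (\<alpha> ! i \<bullet> v - a) \<ge> 0)" .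
  have off: "open_halfspace_gt n v a \<inter> set \<alpha> \<noteq> {} \<or> open_halfspace_lt n v a \<inter> set \<alpha> \<noteq> {} \<longleftrightarrow>
      (\<exists>i<length \<alpha>. \<epsilon> $ i * (\<alpha> ! i \<bullet> v - a) \<noteq> 0)"
  proof -
    have "open_halfspace_gt n v a \<inter> set \<alpha> \<noteq> {} \<or> open_halfspace_lt n v a \<inter> set \<alpha> \<noteq> {} \<longleftrightarrow>
        (\<exists>\<mu>\<in>set \<alpha>. \<mu> \<in> carrier_vec n \<and> v \<bullet> \<mu> \<noteq> a)"
      by (auto simp: open_halfspace_gt_def open_halfspace_lt_def neq_iff)
    also have "\<dots> \<longleftrightarrow> (\<exists>i<length \<alpha>. \<alpha> ! i \<bullet> v \<noteq> a)"
      using \<alpha> comm by (metis in_set_conv_nth)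
    also have "\<dots> \<longleftrightarrow> (\<exists>i<length \<alpha>. \<epsilon> $ i * (\<alpha> ! i \<bullet> v - a) \<noteq> 0)"
      using \<epsilon> by fastforce
    finally show ?thesis .
  qed
  show ?thesis
    unfolding nontrivial_separating_hyperplane_def separating_hyperplane_def sep off
    using v by (metis less_irrefl order_le_less)
qed

text \<open>
  Stiemke's theorem yields an affine function \<open>b + \<alpha> \<bullet> v\<close> that may be constant.  In that case all
  signs are equal to the sign of \<open>b\<close>.  Then \<open>v\<close> can be any nonzero vector (one exists as \<open>n \<ge> 1\<close>),
  provided the constant term is so large that it dominates all the values \<open>\<alpha>\<^sub>i \<bullet> v\<close>.
\<close>

lemma nontrivial_separating_hyperplane_iff:
  assumes n: "n \<ge> 1" and supp: "signed_support n \<alpha> \<epsilon>"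
  shows "(\<exists>v a. nontrivial_separating_hyperplane n \<alpha> \<epsilon> v a) \<longleftrightarrow>
           (\<exists>v\<in>carrier_vec n. \<exists>b. (\<forall>i<length \<alpha>. \<epsilon> $ i * (b + \<alpha> ! i \<bullet> v) \<ge> 0) \<and>
                                  (\<exists>i<length \<alpha>. \<epsilon> $ i * (b + \<alpha> ! i \<bullet> v) > 0))" (is "?L \<longleftrightarrow> ?R")
proof
  assume ?L
  then obtain v a where "nontrivial_separating_hyperplane n \<alpha> \<epsilon> v a"
    by blast
  then show ?R
    unfolding nontrivial_separating_hyperplane_affine_iff[OF supp]
    by (intro bexI[of _ v] exI[of _ "-a"]) auto
next
  assume ?R
  then obtain v b where v: "v \<in> carrier_vec n"
    and nonneg: "\<And>i. i < length \<alpha> \<Longrightarrow> \<epsilon> $ i * (b + \<alpha> ! i \<bullet> v) \<ge> 0"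
    and pos: "\<exists>i<length \<alpha>. \<epsilon> $ i * (b + \<alpha> ! i \<bullet> v) > 0"
    by blast
  show ?L
  proof (cases "v = 0\<^sub>v n")
    case False
    then have "nontrivial_separating_hyperplane n \<alpha> \<epsilon> v (-b)"
      unfolding nontrivial_separating_hyperplane_affine_iff[OF supp]
      using v nonneg pos by (auto simp: add.commute)
    then show ?thesis
      by blast
  next
    case True
    have "\<alpha> ! i \<bullet> v = 0" if "i < length \<alpha>" for i
      using supp that True by (auto simp: signed_support_def subset_iff)
    then have b: "\<epsilon> $ i * b \<ge> 0" "b \<noteq> 0" if "i < length \<alpha>" for i
      using nonneg[OF that] pos that by auto
    have sign: "\<epsilon> $ i = sgn b" if "i < length \<alpha>" for i
      using supp that b[OF that] by (auto simp: signed_support_def sgn_if)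
    define u :: "real vec" where "u = unit_vec n 0"
    define S where "S = 1 + (\<Sum>i<length \<alpha>. \<bar>\<alpha> ! i \<bullet> u\<bar>)"
    have *: "\<epsilon> $ i * (\<alpha> ! i \<bullet> u - (- sgn b * S)) > 0" if i: "i < length \<alpha>" for i
    proof -
      have "\<bar>\<alpha> ! i \<bullet> u\<bar> < S"
        using member_le_sum[of i "{..<length \<alpha>}" "\<lambda>i. \<bar>\<alpha> ! i \<bullet> u\<bar>"] i by (simp add: S_def)
      then show ?thesis
        using b(2)[OF i] sign[OF i] by (auto simp: sgn_if)
    qed
    have "u \<in> carrier_vec n" "u \<noteq> 0\<^sub>v n"
      using n by (auto simp: u_def unit_vec_nonzero)
    then have "nontrivial_separating_hyperplane n \<alpha> \<epsilon> u (- sgn b * S)"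
      unfolding nontrivial_separating_hyperplane_affine_iff[OF supp]
      using * pos by (meson less_imp_le)
    then show ?thesis
      by blast
  qed
qed

section \<open>The equivalence\<close>

text \<open>
  Against an affine dependence with the signs \<open>\<epsilon>\<close>, the values of an affine function, weighted by
  \<open>w\<close>, sum to 0.  Separation makes every summand nonnegative, so all of them vanish.
\<close>

lemma signed_dependence_excludes_separation:
  assumes supp: "signed_support n \<alpha> \<epsilon>"
    and w: "w \<in> coefficient_orthant \<alpha> \<epsilon>" "(\<Sum>i<length \<alpha>. w $ i) = 0"
      "\<forall>j<n. (\<Sum>i<length \<alpha>. w $ i * \<alpha> ! i $ j) = 0"
    and v: "v \<in> carrier_vec n"
    and nonneg: "\<forall>i<length \<alpha>. \<epsilon> $ i * (b + \<alpha> ! i \<bullet> v) \<ge> 0"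
    and i: "i < length \<alpha>"
  shows "\<epsilon> $ i * (b + \<alpha> ! i \<bullet> v) = 0"
proof -
  have sgnw: "sgn (w $ i) = \<epsilon> $ i" if "i < length \<alpha>" for i
    using w(1) that by (auto simp: coefficient_orthant_def)
  then have w_eq: "w $ i = \<bar>w $ i\<bar> * \<epsilon> $ i" if "i < length \<alpha>" for i
    using that by (metis abs_mult_sgn)
  have w_nz: "w $ i \<noteq> 0"
    using sgnw[OF i] supp i by (auto simp: signed_support_def)
  have "(\<Sum>i<length \<alpha>. w $ i * (\<alpha> ! i \<bullet> v)) = (\<Sum>i<length \<alpha>. \<Sum>j<n. v $ j * (w $ i * \<alpha> ! i $ j))"
    using v by (simp add: scalar_prod_def sum_distrib_left atLeast0LessThan mult_ac)
  also have "\<dots> = (\<Sum>j<n. v $ j * (\<Sum>i<length \<alpha>. w $ i * \<alpha> ! i $ j))"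
    unfolding sum_distrib_left by (rule sum.swap)
  also have "\<dots> = 0"
    using w(3) by simp
  finally have "(\<Sum>i<length \<alpha>. w $ i * (b + \<alpha> ! i \<bullet> v)) = 0"
    using w(2) by (simp add: distrib_left sum.distrib flip: sum_distrib_right)
  moreover have "w $ i * (b + \<alpha> ! i \<bullet> v) \<ge> 0" if "i < length \<alpha>" for i
    using nonneg that by (subst w_eq[OF that]) (simp add: mult.assoc)
  ultimately have "w $ i * (b + \<alpha> ! i \<bullet> v) = 0"
    using i by (subst (asm) sum_nonneg_eq_0_iff) auto
  then show ?thesis
    using w_nz by simp
qed

lemma signed_dependence_if_no_separation:
  assumes supp: "signed_support n \<alpha> \<epsilon>"
    and nosep: "\<not> (\<exists>v\<in>carrier_vec n. \<exists>b. (\<forall>i<length \<alpha>. \<epsilon> $ i * (b + \<alpha> ! i \<bullet> v) \<ge> 0) \<and>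
                                       (\<exists>i<length \<alpha>. \<epsilon> $ i * (b + \<alpha> ! i \<bullet> v) > 0))"
  shows "\<exists>w\<in>coefficient_orthant \<alpha> \<epsilon>. (\<Sum>i<length \<alpha>. w $ i) = 0 \<and>
           (\<forall>j<n. (\<Sum>i<length \<alpha>. w $ i * \<alpha> ! i $ j) = 0)"
proof -
  have \<alpha>: "\<alpha> ! i \<in> carrier_vec n" if "i < length \<alpha>" for i
    using supp that by (auto simp: signed_support_def subset_iff)
  define u where "u i = \<epsilon> $ i \<cdot>\<^sub>v vCons 1 (\<alpha> ! i)" for i
  have u: "u i \<in> carrier_vec (Suc n)" if "i < length \<alpha>" for i
    using \<alpha>[OF that] by (simp add: u_def)
  have ux: "u i \<bullet> vCons b v = \<epsilon> $ i * (b + \<alpha> ! i \<bullet> v)"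
    if "i < length \<alpha>" "v \<in> carrier_vec n" for i b v
    using \<alpha>[OF that(1)] that(2) by (simp add: u_def)
  have "\<not> (\<exists>x\<in>carrier_vec (Suc n). (\<forall>i\<in>{..<length \<alpha>}. u i \<bullet> x \<ge> 0) \<and>
              (\<exists>i\<in>{..<length \<alpha>}. u i \<bullet> x > 0))"
  proof
    assume "\<exists>x\<in>carrier_vec (Suc n). (\<forall>i\<in>{..<length \<alpha>}. u i \<bullet> x \<ge> 0) \<and>
              (\<exists>i\<in>{..<length \<alpha>}. u i \<bullet> x > 0)"
    then obtain x where x: "x \<in> carrier_vec (Suc n)" "\<forall>i<length \<alpha>. u i \<bullet> x \<ge> 0"
        "\<exists>i<length \<alpha>. u i \<bullet> x > 0"
      by auto
    obtain b v where "x = vCons b v" "v \<in> carrier_vec n"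
      using x(1) by (cases x) auto
    then have "(\<forall>i<length \<alpha>. \<epsilon> $ i * (b + \<alpha> ! i \<bullet> v) \<ge> 0) \<and>
        (\<exists>i<length \<alpha>. \<epsilon> $ i * (b + \<alpha> ! i \<bullet> v) > 0)"
      using x(2,3) ux by auto
    then show False
      using nosep \<open>v \<in> carrier_vec n\<close> by blast
  qed
  then obtain c where c: "\<forall>i\<in>{..<length \<alpha>}. c i > 0"
    and dep: "\<forall>x\<in>carrier_vec (Suc n). (\<Sum>i<length \<alpha>. c i * (u i \<bullet> x)) = 0"
    using stiemke[of "{..<length \<alpha>}" u "Suc n"] u by auto
  define w where "w = vec (length \<alpha>) (\<lambda>i. c i * \<epsilon> $ i)"
  have "sgn (c i * \<epsilon> $ i) = \<epsilon> $ i" if "i < length \<alpha>" for i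
    using c supp that by (auto simp: signed_support_def sgn_mult)
  then have "w \<in> coefficient_orthant \<alpha> \<epsilon>"
    using supp by (auto simp: coefficient_orthant_def w_def signed_support_def)
  moreover have dep': "(\<Sum>i<length \<alpha>. w $ i * (b + \<alpha> ! i \<bullet> v)) = 0" if "v \<in> carrier_vec n" for b v
  proof -
    have "(\<Sum>i<length \<alpha>. c i * (u i \<bullet> vCons b v)) = 0"
      using dep that by simp
    then show ?thesis
      using that by (simp add: ux w_def mult.assoc)
  qed
  have "(\<Sum>i<length \<alpha>. w $ i) = 0"
    using dep'[of "0\<^sub>v n" 1] \<alpha> by simp
  moreover have "(\<Sum>i<length \<alpha>. w $ i * \<alpha> ! i $ j) = 0" if "j < n" for j
    using dep'[of "unit_vec n j" 0] \<alpha> that by simp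
  ultimately show ?thesis
    by blast
qed

theorem theorem3p3:
  fixes n :: nat and \<alpha> :: "real vec list" and \<epsilon> :: "real vec" and B :: "real mat"
  assumes "n \<ge> 1"
    and "signed_support n \<alpha> \<epsilon>"
    and "gale_dual_matrix n \<alpha> B"
  shows "(signed_discriminant n \<alpha> \<epsilon> = {} \<longleftrightarrow> signed_reduced_discriminant n \<alpha> \<epsilon> B = {}) \<and>
         (signed_discriminant n \<alpha> \<epsilon> = {} \<longleftrightarrow>
           (\<exists>v a. nontrivial_separating_hyperplane n \<alpha> \<epsilon> v a))"
proof
  show "signed_discriminant n \<alpha> \<epsilon> = {} \<longleftrightarrow> signed_reduced_discriminant n \<alpha> \<epsilon> B = {}"
    by (auto simp: signed_reduced_discriminant_def)
  let ?dep = "\<exists>w\<in>coefficient_orthant \<alpha> \<epsilon>. (\<Sum>i<length \<alpha>. w $ i) = 0 \<and>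
      (\<forall>j<n. (\<Sum>i<length \<alpha>. w $ i * \<alpha> ! i $ j) = 0)"
  let ?sep = "\<exists>v\<in>carrier_vec n. \<exists>b. (\<forall>i<length \<alpha>. \<epsilon> $ i * (b + \<alpha> ! i \<bullet> v) \<ge> 0) \<and>
      (\<exists>i<length \<alpha>. \<epsilon> $ i * (b + \<alpha> ! i \<bullet> v) > 0)"
  have "?dep \<Longrightarrow> \<not> ?sep"
  proof
    assume ?dep ?sep
    then obtain w v b i where "w \<in> coefficient_orthant \<alpha> \<epsilon>" "(\<Sum>i<length \<alpha>. w $ i) = 0"
        "\<forall>j<n. (\<Sum>i<length \<alpha>. w $ i * \<alpha> ! i $ j) = 0" "v \<in> carrier_vec n"
        "\<forall>i<length \<alpha>. \<epsilon> $ i * (b + \<alpha> ! i \<bullet> v) \<ge> 0" "i < length \<alpha>"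
      and pos: "\<epsilon> $ i * (b + \<alpha> ! i \<bullet> v) > 0"
      by blast
    then have "\<epsilon> $ i * (b + \<alpha> ! i \<bullet> v) = 0"
      by (intro signed_dependence_excludes_separation[OF assms(2)])
    then show False
      using pos by linarith
  qed
  moreover have "\<not> ?sep \<Longrightarrow> ?dep"
    by (rule signed_dependence_if_no_separation[OF assms(2)])
  moreover have "signed_discriminant n \<alpha> \<epsilon> \<noteq> {} \<longleftrightarrow> ?dep"
    using assms(2) by (intro signed_discriminant_nonempty_iff) (simp add: signed_support_def)
  ultimately show "signed_discriminant n \<alpha> \<epsilon> = {} \<longleftrightarrow>
      (\<exists>v a. nontrivial_separating_hyperplane n \<alpha> \<epsilon> v a)"
    unfolding nontrivial_separating_hyperplane_iff[OF assms(1,2)] by blast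
qed

end
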